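(* Let $\zeta$ and $\hat\zeta$ be charge curves. Consider an instance of the Electric Bus Scheduling Problem with finite non-empty trip set $\mathcal{T}$ such that assigning a unique bus to each trip yields an energy-feasible solution, i.e., for every trip $\tau\in\mathcal{T}$ there is a depot $d$ such that the course $(d,\tau^s,\tau^e,d)$ is operationally admissible and $e(d,\tau^s)+e(\tau^s,\tau^e)+e(\tau^e,d)\le 1$. Then the minimum number of courses of an energy-feasible vehicle schedule (under $\zeta$) is at most $|\mathcal{T}|$ times the minimum number of courses of a weakly energy-feasible vehicle schedule (under $\hat\zeta$). Moreover, the bound is tight: there are charge curves $\zeta,\hat\zeta$ and instances in which for every trip $\tau\in\mathcal{T}$ there is a depot $d$ such that the course $(d,\tau^s,\tau^e,d)$ is operationally admissible and $e(d,\tau^s)+e(\tau^s,\tau^e)+e(\tau^e,d)\le 1$, with arbitrarily large $|\mathcal{T}|$, for which the minimum number of courses of an energy-feasible vehicle schedule (under $\zeta$) equals $|\mathcal{T}|$ times the minimum number of courses of a weakly energy-feasible vehicle schedule (under $\hat\zeta$).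
   Context: **Charge curves.** A charge curve is a function $\zeta:[0,\infty)\to[0,1]$ with $\zeta(0)=0$ for which there is $t_{full}>0$ such that $\zeta$ is strictly increasing on $[0,t_{full}]$, $\zeta(t)=1$ for all $t\ge t_{full}$, and $\zeta$ is absolutely continuous with (almost everywhere existing) derivative $\zeta'$ monotonically non-increasing; in particular $\zeta$ is concave. It maps time spent charging an initially empty battery to the resulting state of charge. Let $\zeta^{-1}:[0,1]\to[0,t_{full}]$ be the inverse of $\zeta|_{[0,t_{full}]}$. The charge increment function is $\Delta\zeta:[0,1]\times[0,\infty)\to[0,1]$, $\Delta\zeta(y,t)=\zeta(\zeta^{-1}(y)+t)-y$. **Instances.** An instance (with one vehicle type) consists of a finite set $\mathcal{T}$ of timetabled trips, each trip $\tau$ having a start $\tau^s$ and an end $\tau^e$ with fixed times; a finite set of depots; a finite set of charging slots, each usable by at most one bus at a time and possibly only during prescribed availability time intervals; information (travel times / admissible connections) on which activities can be performed consecutively by a bus; and a non-negative function $e(\cdot,\cdot)$, the relative energy consumption (as a fraction of the battery capacity) between two locations, with $e(\tau^s,\tau^e)$ the consumption of trip $\tau$. The function $e$ need not be symmetric but satisfies the triangle inequality $e(a,b)\le e(a,c)+e(c,b)$. **Courses and schedules.** A block is a sequence of trips serviced in order without interruption, written as the sequence of starts and ends of its trips. A (vehicle) course is an alternating sequence of $m$ blocks $B_1,\dots,B_m$ and $m-1$ recharge events, starting and ending at the same depot, all operationally admissible (times, connections, slot availability). It is written as the tuple $C=(d^s)\times B_1\times(s_1^s,s_1^e)\times B_2\times\dots\times(s_{m-1}^s,s_{m-1}^e)\times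 B_m\times(d^e)$, where $d^s$ is the initial departure from the depot, $d^e$ the final arrival, and $s_i^s,s_i^e$ are arrival at and departure from the $i$-th recharge event, which has an associated charging duration $t_i\ge 0$. A vehicle schedule is a set of courses that together service every trip of $\mathcal{T}$ exactly once and respect the charging slot capacities. **Energy-feasibility.** Charge states are propagated along $C=(C_1,C_2,\dots)$ by $y(d^s)=1$, $y(s_i^e)=y(s_i^s)+\Delta\zeta(y(s_i^s),t_i)$, and $y(C_j)=y(C_{j-1})-e(C_{j-1},C_j)$ for all other elements. Let $\hat y$ be the map obtained by replacing $\zeta$ by $\hat\zeta$. Let $E(C_j)\ge 0$ be the minimum state of charge required to reach the nearest depot or charge station from location $C_j$. A course is energy-feasible (under $\zeta$) if $y(C_j)\ge E(C_j)$ for all $j$, and weakly energy-feasible if $\hat y(C_j)\ge E(C_j)$ for all $j$. A vehicle schedule has one of these properties if all of its courses do. *)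

theory Defs
  imports "HOL-Analysis.Analysis"
begin

section \<open>Charge curves\<close>

definition absolutely_continuous_fun_on :: "real set \<Rightarrow> (real \<Rightarrow> real) \<Rightarrow> bool" where
  "absolutely_continuous_fun_on S f \<longleftrightarrow>
     (\<forall>\<epsilon>>0. \<exists>\<delta>>0. \<forall>(n::nat) (a :: nat \<Rightarrow> real) b.
        (\<forall>i<n. a i \<le> b i \<and> {a i..b i} \<subseteq> S) \<and>
        (\<forall>i<n. \<forall>j<n. i \<noteq> j \<longrightarrow> {a i<..<b i} \<inter> {a j<..<b j} = {}) \<and>
        (\<Sum>i<n. b i - a i) < \<delta>
        \<longrightarrow> (\<Sum>i<n. \<bar>f (b i) - f (a i)\<bar>) < \<epsilon>)"

definition full_at :: "(real \<Rightarrow> real) \<Rightarrow> real \<Rightarrow> bool" where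
  "full_at \<zeta> T \<longleftrightarrow> T > 0 \<and> strict_mono_on {0..T} \<zeta> \<and> (\<forall>t\<ge>T. \<zeta> t = 1)"

text \<open>A charge curve is a function on the half line \<open>[0, \<infinity>)\<close>; its values at negative arguments
  are irrelevant. The derivative is only required to exist almost everywhere, and to be
  non-increasing on the set where it exists.\<close>

definition charge_curve :: "(real \<Rightarrow> real) \<Rightarrow> bool" where
  "charge_curve \<zeta> \<longleftrightarrow>
     (\<forall>t\<ge>0. \<zeta> t \<in> {0..1}) \<and> \<zeta> 0 = 0 \<and> (\<exists>T. full_at \<zeta> T) \<and>
     absolutely_continuous_fun_on {0..} \<zeta> \<and>
     negligible {t. 0 < t \<and> \<not> \<zeta> differentiable (at t)} \<and>
     antimono_on {t. 0 < t \<and> \<zeta> differentiable (at t)} (deriv \<zeta>)"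

definition t_full :: "(real \<Rightarrow> real) \<Rightarrow> real" where
  "t_full \<zeta> = (THE T. full_at \<zeta> T)"

definition charge_inv :: "(real \<Rightarrow> real) \<Rightarrow> real \<Rightarrow> real" where
  "charge_inv \<zeta> = inv_into {0..t_full \<zeta>} \<zeta>"

text \<open>Meaningful for \<open>y \<in> {0..1}\<close> and \<open>t \<ge> 0\<close> only.\<close>

definition charge_incr :: "(real \<Rightarrow> real) \<Rightarrow> real \<Rightarrow> real \<Rightarrow> real" where
  "charge_incr \<zeta> y t = \<zeta> (charge_inv \<zeta> y + t) - y"


section \<open>Instances\<close>

text \<open>The start and the end of a trip count as locations of their own, so that the consumption
  \<open>e(\<tau>\<^sup>s, \<tau>\<^sup>e)\<close> of a trip is a value of the energy function like any other.\<close>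

datatype ('t, 'd, 's) location =
  TripStart 't | TripEnd 't | Depot 'd | Slot 's

text \<open>\<open>avail I s\<close> is the set of the time intervals in which slot \<open>s\<close> can be used; a slot without
  restrictions has \<open>avail I s = {UNIV}\<close>. \<open>travel\<close> and \<open>conn\<close> give the travel times and the
  admissible connections between activities.\<close>

record ('t, 'd, 's) ebsp_instance =
  trips :: "'t set"
  start_time :: "'t \<Rightarrow> real"
  end_time :: "'t \<Rightarrow> real"
  depots :: "'d set"
  slots :: "'s set"
  avail :: "'s \<Rightarrow> real set set"
  travel :: "('t, 'd, 's) location \<Rightarrow> ('t, 'd, 's) location \<Rightarrow> real"
  conn :: "('t, 'd, 's) location \<Rightarrow> ('t, 'd, 's) location \<Rightarrow> bool"
  energy :: "('t, 'd, 's) location \<Rightarrow> ('t, 'd, 's) location \<Rightarrow> real"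

definition locations :: "('t, 'd, 's) ebsp_instance \<Rightarrow> ('t, 'd, 's) location set" where
  "locations I = TripStart ` trips I \<union> TripEnd ` trips I \<union> Depot ` depots I \<union> Slot ` slots I"

definition valid_instance :: "('t, 'd, 's) ebsp_instance \<Rightarrow> bool" where
  "valid_instance I \<longleftrightarrow>
     finite (trips I) \<and> finite (depots I) \<and> finite (slots I) \<and>
     (\<forall>\<tau>\<in>trips I. start_time I \<tau> \<le> end_time I \<tau>) \<and>
     (\<forall>s\<in>slots I. \<forall>A\<in>avail I s. is_interval A) \<and>
     (\<forall>a\<in>locations I. \<forall>b\<in>locations I. 0 \<le> travel I a b) \<and>
     (\<forall>a\<in>locations I. \<forall>b\<in>locations I. 0 \<le> energy I a b) \<and>
     (\<forall>a\<in>locations I. \<forall>b\<in>locations I. \<forall>c\<in>locations I.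
        energy I a b \<le> energy I a c + energy I c b)"

text \<open>The minimum state of charge \<open>E\<close> needed to reach a depot or charging slot; nothing is needed
  at a depot or charging slot itself.\<close>

definition min_charge :: "('t, 'd, 's) ebsp_instance \<Rightarrow> ('t, 'd, 's) location \<Rightarrow> real" where
  "min_charge I a =
     (let R = Depot ` depots I \<union> Slot ` slots I
      in if a \<in> R then 0 else Min (energy I a ` R))"


section \<open>Courses\<close>

text \<open>A recharge event occupies its slot from arrival to departure; the bus is charged for
  \<open>duration\<close> time units in between.\<close>

datatype 's recharge =
  Recharge (slot: 's) (arrival: real) (departure: real) (duration: real)

text \<open>\<open>Course d B\<^sub>1 [(r\<^sub>1, B\<^sub>2), \<dots>, (r, B)]\<close> leaves depot \<open>d\<close>, serves block \<open>B\<^sub>1\<close>, recharges according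
  to \<open>r\<^sub>1\<close>, serves \<open>B\<^sub>2\<close>, and so on, and returns to \<open>d\<close> after the last block \<open>B\<close>.\<close>

datatype ('t, 'd, 's) course =
  Course (home: 'd) (first_block: "'t list") (later_blocks: "('s recharge \<times> 't list) list")

definition blocks :: "('t, 'd, 's) course \<Rightarrow> 't list list" where
  "blocks C = first_block C # map snd (later_blocks C)"

definition recharges :: "('t, 'd, 's) course \<Rightarrow> 's recharge list" where
  "recharges C = map fst (later_blocks C)"

datatype ('t, 'd, 's) event =
  LeaveDepot 'd | BeginTrip 't | FinishTrip 't |
  BeginRecharge "'s recharge" | FinishRecharge "'s recharge" | ReachDepot 'd

fun loc :: "('t, 'd, 's) event \<Rightarrow> ('t, 'd, 's) location" where
  "loc (LeaveDepot d) = Depot d"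
| "loc (BeginTrip \<tau>) = TripStart \<tau>"
| "loc (FinishTrip \<tau>) = TripEnd \<tau>"
| "loc (BeginRecharge r) = Slot (slot r)"
| "loc (FinishRecharge r) = Slot (slot r)"
| "loc (ReachDepot d) = Depot d"

definition block_events :: "'t list \<Rightarrow> ('t, 'd, 's) event list" where
  "block_events B = concat (map (\<lambda>\<tau>. [BeginTrip \<tau>, FinishTrip \<tau>]) B)"

text \<open>The course written out as the tuple \<open>(C\<^sub>0, C\<^sub>1, \<dots>)\<close>, counting from zero.\<close>

definition events :: "('t, 'd, 's) course \<Rightarrow> ('t, 'd, 's) event list" where
  "events C =
     [LeaveDepot (home C)] @ block_events (first_block C) @
     concat (map (\<lambda>(r, B). [BeginRecharge r, FinishRecharge r] @ block_events B) (later_blocks C)) @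
     [ReachDepot (home C)]"

text \<open>Departure from and return to the depot are not timetabled.\<close>

fun event_time :: "('t, 'd, 's) ebsp_instance \<Rightarrow> ('t, 'd, 's) event \<Rightarrow> real option" where
  "event_time I (LeaveDepot d) = None"
| "event_time I (BeginTrip \<tau>) = Some (start_time I \<tau>)"
| "event_time I (FinishTrip \<tau>) = Some (end_time I \<tau>)"
| "event_time I (BeginRecharge r) = Some (arrival r)"
| "event_time I (FinishRecharge r) = Some (departure r)"
| "event_time I (ReachDepot d) = None"

text \<open>In a course, \<open>BeginTrip\<close> and \<open>BeginRecharge\<close> are followed by the end of the same trip or
  recharge event, so these two cases concern no movement between activities.\<close>

definition admissible_leg ::
    "('t, 'd, 's) ebsp_instance \<Rightarrow> ('t, 'd, 's) event \<Rightarrow> ('t, 'd, 's) event \<Rightarrow> bool" where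
  "admissible_leg I p q \<longleftrightarrow>
     (case p of
        BeginTrip _ \<Rightarrow> True
      | BeginRecharge _ \<Rightarrow> True
      | _ \<Rightarrow> conn I (loc p) (loc q) \<and>
            (case (event_time I p, event_time I q) of
               (Some a, Some b) \<Rightarrow> a + travel I (loc p) (loc q) \<le> b
             | _ \<Rightarrow> True))"

definition admissible_recharge :: "('t, 'd, 's) ebsp_instance \<Rightarrow> 's recharge \<Rightarrow> bool" where
  "admissible_recharge I r \<longleftrightarrow>
     slot r \<in> slots I \<and> 0 \<le> duration r \<and> duration r \<le> departure r - arrival r \<and>
     (\<exists>A\<in>avail I (slot r). {arrival r..departure r} \<subseteq> A)"

definition admissible_course :: "('t, 'd, 's) ebsp_instance \<Rightarrow> ('t, 'd, 's) course \<Rightarrow> bool" where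
  "admissible_course I C \<longleftrightarrow>
     home C \<in> depots I \<and>
     (\<forall>B\<in>set (blocks C). B \<noteq> [] \<and> set B \<subseteq> trips I) \<and>
     (\<forall>r\<in>set (recharges C). admissible_recharge I r) \<and>
     (\<forall>j. Suc j < length (events C) \<longrightarrow> admissible_leg I (events C ! j) (events C ! Suc j))"


section \<open>Vehicle schedules\<close>

text \<open>A bus may enter a slot at the very moment another one leaves it.\<close>

definition slot_conflict :: "'s recharge \<Rightarrow> 's recharge \<Rightarrow> bool" where
  "slot_conflict r r' \<longleftrightarrow>
     slot r = slot r' \<and> \<not> (departure r \<le> arrival r' \<or> departure r' \<le> arrival r)"

definition vehicle_schedule ::
    "('t, 'd, 's) ebsp_instance \<Rightarrow> ('t, 'd, 's) course set \<Rightarrow> bool" where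
  "vehicle_schedule I S \<longleftrightarrow>
     finite S \<and> (\<forall>C\<in>S. admissible_course I C) \<and>
     (\<forall>\<tau>\<in>trips I. (\<Sum>C\<in>S. count_list (concat (blocks C)) \<tau>) = 1) \<and>
     (\<forall>C\<in>S. \<forall>C'\<in>S. C \<noteq> C' \<longrightarrow>
        (\<forall>r\<in>set (recharges C). \<forall>r'\<in>set (recharges C'). \<not> slot_conflict r r'))"


section \<open>Energy feasibility\<close>

text \<open>\<open>charge_state \<zeta> I C j\<close> is \<open>y(C\<^sub>j)\<close>. Once a charge state has become negative, which makes the
  course infeasible, the subsequent values need not be meaningful.\<close>

primrec charge_state ::
    "(real \<Rightarrow> real) \<Rightarrow> ('t, 'd, 's) ebsp_instance \<Rightarrow> ('t, 'd, 's) course \<Rightarrow> nat \<Rightarrow> real" where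
  "charge_state \<zeta> I C 0 = 1"
| "charge_state \<zeta> I C (Suc j) =
     (case events C ! Suc j of
        FinishRecharge r \<Rightarrow>
          charge_state \<zeta> I C j + charge_incr \<zeta> (charge_state \<zeta> I C j) (duration r)
      | q \<Rightarrow> charge_state \<zeta> I C j - energy I (loc (events C ! j)) (loc q))"

text \<open>Weak energy feasibility is \<open>energy_feasible\<close> for the other charge curve.\<close>

definition energy_feasible ::
    "(real \<Rightarrow> real) \<Rightarrow> ('t, 'd, 's) ebsp_instance \<Rightarrow> ('t, 'd, 's) course \<Rightarrow> bool" where
  "energy_feasible \<zeta> I C \<longleftrightarrow>
     (\<forall>j<length (events C). min_charge I (loc (events C ! j)) \<le> charge_state \<zeta> I C j)"

definition energy_feasible_schedule ::
    "(real \<Rightarrow> real) \<Rightarrow> ('t, 'd, 's) ebsp_instance \<Rightarrow> ('t, 'd, 's) course set \<Rightarrow> bool" where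
  "energy_feasible_schedule \<zeta> I S \<longleftrightarrow>
     vehicle_schedule I S \<and> (\<forall>C\<in>S. energy_feasible \<zeta> I C)"

text \<open>Being the minimum includes that it is attained, so that a feasible schedule exists.\<close>

definition is_min_courses ::
    "(real \<Rightarrow> real) \<Rightarrow> ('t, 'd, 's) ebsp_instance \<Rightarrow> nat \<Rightarrow> bool" where
  "is_min_courses \<zeta> I n \<longleftrightarrow>
     (\<exists>S. energy_feasible_schedule \<zeta> I S \<and> card S = n) \<and>
     (\<forall>S. energy_feasible_schedule \<zeta> I S \<longrightarrow> n \<le> card S)"

definition one_bus_per_trip :: "('t, 'd, 's) ebsp_instance \<Rightarrow> bool" where
  "one_bus_per_trip I \<longleftrightarrow>
     (\<forall>\<tau>\<in>trips I. \<exists>d\<in>depots I.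
        admissible_course I (Course d [\<tau>] []) \<and>
        energy I (Depot d) (TripStart \<tau>) + energy I (TripStart \<tau>) (TripEnd \<tau>) +
          energy I (TripEnd \<tau>) (Depot d) \<le> 1)"

end

theory Submission
  imports Defs
begin

text \<open>Giving every trip its own bus involves no recharging, so this schedule is energy-feasible
  under every charge curve and needs \<open>card (trips I)\<close> courses, while every schedule needs at least
  one course because there is a trip. This is the bound
  (\<open>min_courses_le_card_trips\<close>, \<open>min_courses_pos\<close>).

  For tightness the two charge curves must disagree on whether a bus can ever serve a second trip.
  Let the battery be filled at constant speed, within one time unit under \<open>\<zeta>\<close> and within half a
  time unit under \<open>\<zeta>'\<close>. Every trip uses a full battery, and after every trip the only charging slot
  is open for half a time unit. Under \<open>\<zeta>'\<close> one bus recharges fully between any two consecutive trips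
  and serves them all. Under \<open>\<zeta>\<close> a bus that has served one trip can get at most half a battery before
  the next one, since the blocks between recharge events are non-empty; hence no bus serves two trips
  (\<open>relay_course_single_trip\<close>) and there are at least as many courses as trips.\<close>

section \<open>One course per trip\<close>

lemma min_charge_le_energy_to_depot:
  assumes "valid_instance I" "d \<in> depots I" "a \<in> locations I"
  shows "min_charge I a \<le> energy I a (Depot d)"
proof -
  have "0 \<le> energy I a (Depot d)"
    using assms by (auto simp: valid_instance_def locations_def)
  moreover have "Min (energy I a ` (Depot ` depots I \<union> Slot ` slots I)) \<le> energy I a (Depot d)"
    using assms by (intro Min_le) (auto simp: valid_instance_def)
  ultimately show ?thesis
    by (auto simp: min_charge_def Let_def)
qed

text \<open>The triangle inequality turns the energy balance at the end of the course into the
  reserve \<open>E\<close> at the two ends of the trip, because the home depot is one of the refuges over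
  which \<open>E\<close> is a minimum.\<close>

lemma energy_feasible_single_trip_course:
  assumes "valid_instance I" "\<tau> \<in> trips I" "d \<in> depots I"
    and budget: "energy I (Depot d) (TripStart \<tau>) + energy I (TripStart \<tau>) (TripEnd \<tau>) +
          energy I (TripEnd \<tau>) (Depot d) \<le> 1"
  shows "energy_feasible \<zeta> I (Course d [\<tau>] [])"
proof -
  have locs: "TripStart \<tau> \<in> locations I" "TripEnd \<tau> \<in> locations I" "Depot d \<in> locations I"
    using assms by (auto simp: locations_def)
  have evs: "events (Course d [\<tau>] []) = [LeaveDepot d, BeginTrip \<tau>, FinishTrip \<tau>, ReachDepot d]"
    by (simp add: events_def block_events_def)
  have "energy I (TripStart \<tau>) (Depot d)
      \<le> energy I (TripStart \<tau>) (TripEnd \<tau>) + energy I (TripEnd \<tau>) (Depot d)"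
    using assms(1) locs unfolding valid_instance_def by blast
  moreover have "min_charge I (Depot d) = 0"
    using assms(3) by (simp add: min_charge_def)
  moreover note min_charge_le_energy_to_depot[OF assms(1,3) locs(1)]
    min_charge_le_energy_to_depot[OF assms(1,3) locs(2)] budget
  ultimately show ?thesis
    unfolding energy_feasible_def evs
    by (auto simp: evs less_Suc_eq numeral_eq_Suc)
qed

lemma one_course_per_trip_schedule:
  fixes I :: "('t, 'd, 's) ebsp_instance"
  assumes "valid_instance I" "one_bus_per_trip I"
  shows "\<exists>S. energy_feasible_schedule \<zeta> I S \<and> card S = card (trips I)"
proof -
  obtain d where d: "\<And>\<tau>. \<tau> \<in> trips I \<Longrightarrow> d \<tau> \<in> depots I \<and>
        admissible_course I (Course (d \<tau>) [\<tau>] []) \<and>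
        energy I (Depot (d \<tau>)) (TripStart \<tau>) + energy I (TripStart \<tau>) (TripEnd \<tau>) +
          energy I (TripEnd \<tau>) (Depot (d \<tau>)) \<le> 1"
    using assms(2) unfolding one_bus_per_trip_def by metis
  define course_of where "course_of = (\<lambda>\<tau>. Course (d \<tau>) [\<tau>] [] :: ('t, 'd, 's) course)"
  have inj: "inj_on course_of (trips I)"
    by (auto simp: inj_on_def course_of_def)
  have fin: "finite (trips I)"
    using assms(1) by (simp add: valid_instance_def)
  have "(\<Sum>C\<in>course_of ` trips I. count_list (concat (blocks C)) \<tau>) = 1" if "\<tau> \<in> trips I" for \<tau>
  proof -
    have "(\<Sum>C\<in>course_of ` trips I. count_list (concat (blocks C)) \<tau>)
        = (\<Sum>\<sigma>\<in>trips I. if \<sigma> = \<tau> then 1 else 0)"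
      using inj by (subst sum.reindex) (simp_all add: course_of_def blocks_def cong: if_cong)
    then show ?thesis
      using fin that by simp
  qed
  then have "vehicle_schedule I (course_of ` trips I)"
    using d fin by (auto simp: vehicle_schedule_def course_of_def recharges_def)
  moreover have "\<forall>C\<in>course_of ` trips I. energy_feasible \<zeta> I C"
    using d energy_feasible_single_trip_course[OF assms(1)] by (auto simp: course_of_def)
  ultimately show ?thesis
    using card_image[OF inj] by (auto simp: energy_feasible_schedule_def)
qed

lemma vehicle_schedule_card_pos:
  assumes "vehicle_schedule I S" "trips I \<noteq> {}"
  shows "0 < card S"
proof -
  have "S \<noteq> {}"
    using assms by (auto simp: vehicle_schedule_def)
  then show ?thesis
    using assms(1) by (auto simp: vehicle_schedule_def card_gt_0_iff)
qed

lemma min_courses_exists: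
  assumes "energy_feasible_schedule \<zeta> I S"
  shows "\<exists>n\<le>card S. is_min_courses \<zeta> I n"
proof -
  define P where "P = (\<lambda>n. \<exists>S. energy_feasible_schedule \<zeta> I S \<and> card S = n)"
  have "P (card S)"
    using assms by (auto simp: P_def)
  then have "P (Least P)" "Least P \<le> card S" "\<And>n. P n \<Longrightarrow> Least P \<le> n"
    by (auto intro: LeastI Least_le)
  then show ?thesis
    unfolding is_min_courses_def P_def by blast
qed

lemma min_courses_pos:
  assumes "is_min_courses \<zeta> I n" "trips I \<noteq> {}"
  shows "0 < n"
  using assms vehicle_schedule_card_pos
  by (force simp: is_min_courses_def energy_feasible_schedule_def)

lemma min_courses_le_card_trips:
  assumes "valid_instance I" "one_bus_per_trip I"
  shows "\<exists>n\<le>card (trips I). is_min_courses \<zeta> I n"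
proof -
  obtain S where "energy_feasible_schedule \<zeta> I S" "card S = card (trips I)"
    using one_course_per_trip_schedule[OF assms] by blast
  then show ?thesis
    using min_courses_exists by metis
qed

text \<open>Count the services of all trips by all courses in two ways: every trip contributes exactly one
  of them and every course at most one.\<close>

lemma card_trips_le_card_schedule:
  assumes "vehicle_schedule I S" "finite (trips I)"
    and "\<And>C. C \<in> S \<Longrightarrow> length (concat (blocks C)) \<le> 1"
  shows "card (trips I) \<le> card S"
proof -
  have "card (trips I) = (\<Sum>\<tau>\<in>trips I. \<Sum>C\<in>S. count_list (concat (blocks C)) \<tau>)"
    using assms(1) by (simp add: vehicle_schedule_def)
  also have "\<dots> = (\<Sum>C\<in>S. \<Sum>\<tau>\<in>trips I. count_list (concat (blocks C)) \<tau>)"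
    by (rule sum.swap)
  also have "\<dots> \<le> (\<Sum>C\<in>S. 1)"
  proof (rule sum_mono)
    fix C assume C: "C \<in> S"
    then have "set (concat (blocks C)) \<subseteq> trips I"
      using assms(1) by (fastforce simp: vehicle_schedule_def admissible_course_def)
    then have "(\<Sum>\<tau>\<in>trips I. count_list (concat (blocks C)) \<tau>) = length (concat (blocks C))"
      using assms(2) by (rule sum_count_set)
    then show "(\<Sum>\<tau>\<in>trips I. count_list (concat (blocks C)) \<tau>) \<le> 1"
      using assms(3)[OF C] by simp
  qed
  finally show ?thesis by simp
qed


section \<open>Capped linear charge curves\<close>

text \<open>Charging at constant speed \<open>c\<close> until the battery is full.\<close>

definition capped_linear :: "real \<Rightarrow> real \<Rightarrow> real" where
  "capped_linear c t = min (c * t) 1"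

lemma absolutely_continuous_fun_on_lipschitz:
  assumes "0 \<le> L" and "\<And>x y. x \<in> S \<Longrightarrow> y \<in> S \<Longrightarrow> \<bar>f y - f x\<bar> \<le> L * \<bar>y - x\<bar>"
  shows "absolutely_continuous_fun_on S f"
  unfolding absolutely_continuous_fun_on_def
proof (intro allI impI)
  fix \<epsilon> :: real assume "0 < \<epsilon>"
  have "(\<Sum>i<n. \<bar>f (b i) - f (a i)\<bar>) < \<epsilon>"
    if sub: "\<forall>i<n. a i \<le> b i \<and> {a i..b i} \<subseteq> S" and short: "(\<Sum>i<n. b i - a i) < \<epsilon> / (L + 1)"
    for n :: nat and a b :: "nat \<Rightarrow> real"
  proof -
    have "\<bar>f (b i) - f (a i)\<bar> \<le> (L + 1) * (b i - a i)" if "i < n" for i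
    proof -
      have "a i \<le> b i" "{a i..b i} \<subseteq> S"
        using sub that by auto
      then have "a i \<le> b i" "a i \<in> S" "b i \<in> S"
        by auto
      then show ?thesis
        using assms(2)[of "a i" "b i"] by (simp add: algebra_simps)
    qed
    then have "(\<Sum>i<n. \<bar>f (b i) - f (a i)\<bar>) \<le> (L + 1) * (\<Sum>i<n. b i - a i)"
      unfolding sum_distrib_left by (intro sum_mono) auto
    also have "\<dots> < \<epsilon>"
      using short assms(1) by (simp add: field_simps)
    finally show ?thesis .
  qed
  moreover have "0 < \<epsilon> / (L + 1)"
    using \<open>0 < \<epsilon>\<close> assms(1) by simp
  ultimately show "\<exists>\<delta>>0. \<forall>(n::nat) (a :: nat \<Rightarrow> real) b.
        (\<forall>i<n. a i \<le> b i \<and> {a i..b i} \<subseteq> S) \<and>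
        (\<forall>i<n. \<forall>j<n. i \<noteq> j \<longrightarrow> {a i<..<b i} \<inter> {a j<..<b j} = {}) \<and>
        (\<Sum>i<n. b i - a i) < \<delta>
        \<longrightarrow> (\<Sum>i<n. \<bar>f (b i) - f (a i)\<bar>) < \<epsilon>"
    by blast
qed

lemma capped_linear_has_derivative_below:
  assumes "0 < c" "t < 1 / c"
  shows "(capped_linear c has_real_derivative c) (at t)"
proof (rule has_field_derivative_transform_within_open[where S = "{..<1 / c}"])
  show "((\<lambda>t. c * t) has_real_derivative c) (at t)"
    by (auto intro!: derivative_eq_intros)
qed (use assms in \<open>auto simp: capped_linear_def field_simps\<close>)

lemma capped_linear_has_derivative_above:
  assumes "0 < c" "1 / c < t"
  shows "(capped_linear c has_real_derivative 0) (at t)"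
proof (rule has_field_derivative_transform_within_open[where S = "{1 / c<..}"])
  show "((\<lambda>t. 1) has_real_derivative 0) (at t)"
    by (auto intro!: derivative_eq_intros)
qed (use assms in \<open>auto simp: capped_linear_def field_simps\<close>)

lemma capped_linear_not_differentiable_at_kink:
  assumes "0 < c"
  shows "\<not> capped_linear c differentiable (at (1 / c))"
proof
  assume "capped_linear c differentiable (at (1 / c))"
  \<comment> \<open>The derivative would agree with both one-sided derivatives, which are \<open>c\<close> and \<open>0\<close>.\<close>
  then obtain D where D: "(capped_linear c has_real_derivative D) (at (1 / c))"
    by (auto simp: real_differentiable_def)
  have "((\<lambda>t. c * t) has_real_derivative D) (at (1 / c) within {..1 / c})"
    by (rule has_field_derivative_transform_within[OF has_field_derivative_at_within[OF D], where d = 1])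
      (use assms in \<open>auto simp: capped_linear_def field_simps\<close>)
  moreover have "((\<lambda>t. c * t) has_real_derivative c) (at (1 / c) within {..1 / c})"
    by (auto intro!: derivative_eq_intros)
  ultimately have "D = c"
    by (rule has_field_derivative_unique) (simp add: at_within_Iic_at_left)
  have "((\<lambda>t. 1) has_real_derivative D) (at (1 / c) within {1 / c..})"
    by (rule has_field_derivative_transform_within[OF has_field_derivative_at_within[OF D], where d = 1])
      (use assms in \<open>auto simp: capped_linear_def field_simps\<close>)
  moreover have "((\<lambda>t. 1) has_real_derivative 0) (at (1 / c) within {1 / c..})"
    by (auto intro!: derivative_eq_intros)
  ultimately have "D = 0"
    by (rule has_field_derivative_unique) (simp add: at_within_Ici_at_right)
  with \<open>D = c\<close> assms show False by simp
qed

lemma charge_curve_capped_linear: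
  assumes "0 < c"
  shows "charge_curve (capped_linear c)"
proof -
  have "full_at (capped_linear c) (1 / c)"
    using assms by (auto simp: full_at_def strict_mono_on_def capped_linear_def min_def field_simps)
  moreover have "absolutely_continuous_fun_on {0..} (capped_linear c)"
  proof (rule absolutely_continuous_fun_on_lipschitz)
    show "\<bar>capped_linear c y - capped_linear c x\<bar> \<le> c * \<bar>y - x\<bar>" for x y
    proof -
      have "\<bar>capped_linear c y - capped_linear c x\<bar> \<le> \<bar>c * y - c * x\<bar>"
        by (auto simp: capped_linear_def)
      also have "\<dots> = c * \<bar>y - x\<bar>"
        using assms by (simp add: abs_mult flip: right_diff_distrib)
      finally show ?thesis .
    qed
  qed (use assms in simp)
  moreover have "negligible {t. 0 < t \<and> \<not> capped_linear c differentiable (at t)}"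
  proof (rule negligible_subset)
    show "{t. 0 < t \<and> \<not> capped_linear c differentiable (at t)} \<subseteq> {1 / c}"
      using capped_linear_has_derivative_below[OF assms] capped_linear_has_derivative_above[OF assms]
      by (auto simp: real_differentiable_def) (meson linorder_neqE_linordered_idom)
  qed simp
  moreover have "antimono_on {t. 0 < t \<and> capped_linear c differentiable (at t)}
      (deriv (capped_linear c))"
  proof (rule monotone_onI)
    fix s t
    assume "s \<in> {t. 0 < t \<and> capped_linear c differentiable (at t)}"
      and "t \<in> {t. 0 < t \<and> capped_linear c differentiable (at t)}" and "s \<le> t"
    then have "s < 1 / c \<or> 1 / c < s" "t < 1 / c \<or> 1 / c < t"
      using capped_linear_not_differentiable_at_kink[OF assms] by (metis linorder_neqE_linordered_idom mem_Collect_eq)+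
    then show "deriv (capped_linear c) s \<ge> deriv (capped_linear c) t"
      using \<open>s \<le> t\<close> assms DERIV_imp_deriv[OF capped_linear_has_derivative_below[OF assms]]
        DERIV_imp_deriv[OF capped_linear_has_derivative_above[OF assms]]
      by auto
  qed
  ultimately show ?thesis
    using assms by (auto simp: charge_curve_def capped_linear_def)
qed

lemma charge_inv_zero:
  assumes "charge_curve \<zeta>"
  shows "charge_inv \<zeta> 0 = 0"
proof -
  obtain T where T: "full_at \<zeta> T"
    using assms by (auto simp: charge_curve_def)
  \<comment> \<open>Two full times would both have value 1, against strict monotonicity up to the later one.\<close>
  have "\<not> (full_at \<zeta> U \<and> full_at \<zeta> V \<and> U < V)" for U V
    by (auto simp: full_at_def strict_mono_on_def) (metis less_eq_real_def less_irrefl less_trans)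
  then have "t_full \<zeta> = T"
    unfolding t_full_def using T by (metis linorder_neqE_linordered_idom the_equality)
  then have "inj_on \<zeta> {0..t_full \<zeta>}" "0 \<in> {0..t_full \<zeta>}"
    using T by (auto simp: full_at_def intro: strict_mono_on_imp_inj_on)
  then have "inv_into {0..t_full \<zeta>} \<zeta> (\<zeta> 0) = 0"
    by (rule inv_into_f_f)
  then show ?thesis
    using assms by (simp add: charge_inv_def charge_curve_def)
qed

text \<open>In the example for tightness a bus arrives at the slot with an empty battery, so this lemma
  evaluates its recharge events.\<close>

lemma charge_incr_empty:
  assumes "charge_curve \<zeta>"
  shows "charge_incr \<zeta> 0 t = \<zeta> t"
  by (simp add: charge_incr_def charge_inv_zero[OF assms])


section \<open>The relay instance\<close>

fun trip_end :: "('t, 'd, 's) location \<Rightarrow> bool" where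
  "trip_end (TripEnd \<tau>) = True"
| "trip_end _ = False"

text \<open>Entering the set of trip ends costs a full battery and every other move is free; as the
  indicator of leaving one set for its complement, this satisfies the triangle inequality. Hence
  a trip uses the whole battery, and depot and slot can be reached for free from everywhere.
  Trip \<open>i\<close> takes place at time \<open>i\<close>, and the slot is open for the half time unit that follows.\<close>

definition relay_instance :: "nat \<Rightarrow> (nat, nat, nat) ebsp_instance" where
  "relay_instance N =
     \<lparr>trips = {..N}, start_time = real, end_time = real, depots = {0}, slots = {0},
      avail = (\<lambda>_. range (\<lambda>i::nat. {real i..real i + 1 / 2})),
      travel = (\<lambda>_ _. 0), conn = (\<lambda>_ _. True),
      energy = (\<lambda>a b. if trip_end b \<and> \<not> trip_end a then 1 else 0)\<rparr>"

lemma valid_relay_instance: "valid_instance (relay_instance N)"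
  by (auto simp: valid_instance_def relay_instance_def)

lemma min_charge_relay_instance [simp]: "min_charge (relay_instance N) a = 0"
  by (auto simp: min_charge_def relay_instance_def Let_def)

lemma one_bus_per_trip_relay_instance: "one_bus_per_trip (relay_instance N)"
  by (auto simp: one_bus_per_trip_def admissible_course_def relay_instance_def blocks_def
      recharges_def events_def block_events_def admissible_leg_def less_Suc_eq)

lemma relay_recharge_duration:
  assumes "admissible_recharge (relay_instance N) r"
  shows "0 \<le> duration r" "duration r \<le> 1 / 2"
proof -
  obtain i :: nat where "{arrival r..departure r} \<subseteq> {real i..real i + 1 / 2}"
    and dur: "0 \<le> duration r" "duration r \<le> departure r - arrival r"
    using assms by (auto simp: admissible_recharge_def relay_instance_def)
  then have "departure r - arrival r \<le> 1 / 2"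
    by auto
  with dur show "0 \<le> duration r" "duration r \<le> 1 / 2"
    by simp_all
qed

text \<open>The first trip empties the battery. A second trip needs a full one, but half a time unit
  of recharging at unit speed restores only half of it, and blocks are non-empty, so that no two
  recharge events are consecutive.\<close>

lemma relay_course_single_trip:
  assumes adm: "admissible_course (relay_instance N) C"
    and feas: "energy_feasible (capped_linear 1) (relay_instance N) C"
  shows "length (concat (blocks C)) \<le> 1"
proof -
  let ?I = "relay_instance N"
  let ?y = "charge_state (capped_linear 1) ?I C"
  have nonneg: "0 \<le> ?y j" if "j < length (events C)" for j
    using feas that by (simp add: energy_feasible_def)
  obtain d B L where C: "C = Course d B L"
    by (cases C)
  have blocks_ne: "\<forall>B\<in>set (blocks C). B \<noteq> []"
    using adm by (simp add: admissible_course_def)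
  then obtain \<tau> B' where B: "B = \<tau> # B'"
    by (auto simp: C blocks_def neq_Nil_conv)
  have evs: "events C = LeaveDepot d # BeginTrip \<tau> # FinishTrip \<tau> # block_events B' @
      concat (map (\<lambda>(r, B). [BeginRecharge r, FinishRecharge r] @ block_events B) L) @ [ReachDepot d]"
    by (simp add: C B events_def block_events_def)
  have y2: "?y 2 = 0"
    by (simp add: evs numeral_eq_Suc relay_instance_def)
  show ?thesis
  proof (cases B')
    case (Cons \<sigma> B'')
    have "?y 4 < 0"
      using y2 by (simp add: evs Cons block_events_def numeral_eq_Suc relay_instance_def)
    moreover have "4 < length (events C)"
      by (simp add: evs Cons block_events_def)
    ultimately show ?thesis
      using nonneg[of 4] by simp
  next
    case Nil
    show ?thesis
    proof (cases L)
      case Nil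
      then show ?thesis by (simp add: C B \<open>B' = []\<close> blocks_def)
    next
      case (Cons rb L')
      then obtain r \<sigma> D where rb: "rb = (r, \<sigma> # D)"
        using blocks_ne by (cases rb) (auto simp: C blocks_def neq_Nil_conv)
      have "\<exists>E. events C = LeaveDepot d # BeginTrip \<tau> # FinishTrip \<tau> # BeginRecharge r #
          FinishRecharge r # BeginTrip \<sigma> # FinishTrip \<sigma> # E"
        by (simp add: evs Nil Cons rb block_events_def)
      then obtain E where E: "events C = LeaveDepot d # BeginTrip \<tau> # FinishTrip \<tau> # BeginRecharge r #
          FinishRecharge r # BeginTrip \<sigma> # FinishTrip \<sigma> # E" ..
      have "admissible_recharge ?I r"
        using adm by (simp add: admissible_course_def recharges_def C Cons rb)
      then have "capped_linear 1 (duration r) \<le> 1 / 2"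
        using relay_recharge_duration(2)[of N r] by (simp add: capped_linear_def)
      moreover have "?y 6 = capped_linear 1 (duration r) - 1"
        using y2 by (simp add: E numeral_eq_Suc relay_instance_def charge_incr_empty
            charge_curve_capped_linear)
      moreover have "6 < length (events C)"
        by (simp add: E)
      ultimately show ?thesis
        using nonneg[of 6] by simp
    qed
  qed
qed


section \<open>A single fast-charging course\<close>

definition relay_recharge :: "nat \<Rightarrow> nat recharge" where
  "relay_recharge i = Recharge 0 (real i) (real i + 1 / 2) (1 / 2)"

definition relay_course :: "nat \<Rightarrow> (nat, nat, nat) course" where
  "relay_course N = Course 0 [0] (map (\<lambda>i. (relay_recharge i, [Suc i])) [0..<N])"

text \<open>Admissibility and charge states of the relay course are local properties of consecutive
  events, so this relation is all that needs to be known about its event list.\<close>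

inductive relay_step :: "(nat, nat, nat) event \<Rightarrow> (nat, nat, nat) event \<Rightarrow> bool" where
  "relay_step (LeaveDepot 0) (BeginTrip 0)"
| "relay_step (BeginTrip i) (FinishTrip i)"
| "relay_step (FinishTrip i) (BeginRecharge (relay_recharge i))"
| "relay_step (BeginRecharge (relay_recharge i)) (FinishRecharge (relay_recharge i))"
| "relay_step (FinishRecharge (relay_recharge i)) (BeginTrip (Suc i))"
| "relay_step (FinishTrip i) (ReachDepot 0)"

lemma successively_relay_step: "successively relay_step (events (relay_course N))"
proof -
  define L where "L = (\<lambda>n. [LeaveDepot 0, BeginTrip 0, FinishTrip 0] @
      concat (map (\<lambda>i. [BeginRecharge (relay_recharge i), FinishRecharge (relay_recharge i),
        BeginTrip (Suc i), FinishTrip (Suc i)]) [0..<n]) :: (nat, nat, nat) event list)"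
  have "successively relay_step (L n) \<and> last (L n) = FinishTrip n \<and> L n \<noteq> []" for n
  proof (induction n)
    case 0
    show ?case by (auto simp: L_def intro: relay_step.intros)
  next
    case (Suc n)
    have "L (Suc n) = L n @ [BeginRecharge (relay_recharge n), FinishRecharge (relay_recharge n),
        BeginTrip (Suc n), FinishTrip (Suc n)]"
      by (simp add: L_def)
    with Suc.IH show ?case
      by (auto simp: successively_append_iff intro: relay_step.intros)
  qed
  moreover have "events (relay_course N) = L N @ [ReachDepot 0]"
    by (simp add: events_def relay_course_def L_def block_events_def comp_def)
  ultimately show ?thesis
    by (auto simp: successively_append_iff intro: relay_step.intros)
qed

lemma relay_step_nth:
  assumes "Suc j < length (events (relay_course N))"
  shows "relay_step (events (relay_course N) ! j) (events (relay_course N) ! Suc j)"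
  using successively_relay_step[of N] assms by (simp add: successively_conv_nth)

lemma admissible_relay_course: "admissible_course (relay_instance N) (relay_course N)"
proof -
  have "admissible_leg (relay_instance N) p q" if "relay_step p q" for p q
    using that by cases (auto simp: admissible_leg_def relay_instance_def relay_recharge_def)
  moreover have "admissible_recharge (relay_instance N) (relay_recharge i)" for i
    by (auto simp: admissible_recharge_def relay_recharge_def relay_instance_def)
  ultimately show ?thesis
    using relay_step_nth[of _ N]
    by (auto simp: admissible_course_def relay_course_def blocks_def recharges_def
        relay_instance_def)
qed

fun battery_empty :: "('t, 'd, 's) event \<Rightarrow> bool" where
  "battery_empty (FinishTrip \<tau>) = True"
| "battery_empty (BeginRecharge r) = True"
| "battery_empty (ReachDepot d) = True"
| "battery_empty _ = False"

text \<open>At double speed, half a time unit fills the empty battery, so that the battery is always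
  either full or empty.\<close>

lemma charge_state_relay_course:
  assumes "j < length (events (relay_course N))"
  shows "charge_state (capped_linear 2) (relay_instance N) (relay_course N) j =
    (if battery_empty (events (relay_course N) ! j) then 0 else 1)"
  using assms
proof (induction j)
  case 0
  show ?case by (simp add: events_def)
next
  case (Suc j)
  have full: "charge_incr (capped_linear 2) 0 (duration (relay_recharge i)) = 1" for i
    by (simp add: charge_incr_empty charge_curve_capped_linear)
      (simp add: capped_linear_def relay_recharge_def)
  have "relay_step (events (relay_course N) ! j) (events (relay_course N) ! Suc j)"
    using Suc.prems by (rule relay_step_nth)
  then show ?case
    using Suc.IH Suc.prems full by cases (auto simp: relay_instance_def)
qed

lemma energy_feasible_schedule_relay_course:
  "energy_feasible_schedule (capped_linear 2) (relay_instance N) {relay_course N}"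
proof -
  have feas: "energy_feasible (capped_linear 2) (relay_instance N) (relay_course N)"
    by (simp add: energy_feasible_def charge_state_relay_course)
  have "concat (blocks (relay_course N)) = [0..<Suc N]"
  proof -
    have "concat (blocks (relay_course N)) = 0 # map Suc [0..<N]"
      by (simp add: blocks_def relay_course_def comp_def)
    then show ?thesis
      by (simp only: map_Suc_upt) (simp add: upt_conv_Cons del: upt_Suc)
  qed
  moreover have "count_list [0..<n] \<tau> = (if \<tau> < n then 1 else 0)" for n \<tau>
    by (induction n) auto
  ultimately have "count_list (concat (blocks (relay_course N))) \<tau> = 1" if "\<tau> \<le> N" for \<tau>
    using that by (simp del: upt_Suc)
  then show ?thesis
    using feas admissible_relay_course[of N]
    by (simp add: energy_feasible_schedule_def vehicle_schedule_def relay_instance_def)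
qed

lemma min_courses_relay_instance_slow:
  "is_min_courses (capped_linear 1) (relay_instance N) (card (trips (relay_instance N)))"
proof -
  have "card (trips (relay_instance N)) \<le> card S"
    if "energy_feasible_schedule (capped_linear 1) (relay_instance N) S" for S
  proof (rule card_trips_le_card_schedule)
    show "vehicle_schedule (relay_instance N) S"
      using that by (simp add: energy_feasible_schedule_def)
    show "finite (trips (relay_instance N))"
      by (simp add: relay_instance_def)
    show "length (concat (blocks C)) \<le> 1" if "C \<in> S" for C
      using \<open>energy_feasible_schedule _ _ S\<close> that relay_course_single_trip
      by (auto simp: energy_feasible_schedule_def vehicle_schedule_def)
  qed
  then show ?thesis
    using one_course_per_trip_schedule[OF valid_relay_instance one_bus_per_trip_relay_instance]
    by (auto simp: is_min_courses_def)
qed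

lemma min_courses_relay_instance_fast:
  "is_min_courses (capped_linear 2) (relay_instance N) 1"
proof -
  have "trips (relay_instance N) \<noteq> {}"
    by (auto simp: relay_instance_def)
  then have "1 \<le> card S" if "energy_feasible_schedule (capped_linear 2) (relay_instance N) S" for S
    using that vehicle_schedule_card_pos[of "relay_instance N" S]
    by (simp add: energy_feasible_schedule_def)
  then show ?thesis
    using energy_feasible_schedule_relay_course[of N]
    by (force simp: is_min_courses_def)
qed


section \<open>The bound and its tightness\<close>

theorem corollary4p9:
  shows "(\<forall>\<zeta> \<zeta>' (I :: ('t, 'd, 's) ebsp_instance).
            charge_curve \<zeta> \<and> charge_curve \<zeta>' \<and>
            valid_instance I \<and> trips I \<noteq> {} \<and> one_bus_per_trip I \<longrightarrow>
            (\<exists>n m. is_min_courses \<zeta> I n \<and> is_min_courses \<zeta>' I m \<and> n \<le> card (trips I) * m)) \<and>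
         (\<exists>\<zeta> \<zeta>'. charge_curve \<zeta> \<and> charge_curve \<zeta>' \<and>
            (\<forall>N. \<exists>I :: (nat, nat, nat) ebsp_instance.
               valid_instance I \<and> trips I \<noteq> {} \<and> one_bus_per_trip I \<and> N \<le> card (trips I) \<and>
               (\<exists>n m. is_min_courses \<zeta> I n \<and> is_min_courses \<zeta>' I m \<and> n = card (trips I) * m)))"
proof (intro conjI allI impI)
  fix \<zeta> \<zeta>' and I :: "('t, 'd, 's) ebsp_instance"
  assume asm: "charge_curve \<zeta> \<and> charge_curve \<zeta>' \<and>
      valid_instance I \<and> trips I \<noteq> {} \<and> one_bus_per_trip I"
  then obtain n m where nm: "n \<le> card (trips I)" "is_min_courses \<zeta> I n" "is_min_courses \<zeta>' I m"
    using min_courses_le_card_trips by metis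
  then have "0 < m"
    using min_courses_pos asm by blast
  then have "card (trips I) \<le> card (trips I) * m"
    by simp
  with nm(1) have "n \<le> card (trips I) * m"
    by (rule order_trans)
  with nm show "\<exists>n m. is_min_courses \<zeta> I n \<and> is_min_courses \<zeta>' I m \<and> n \<le> card (trips I) * m"
    by blast
next
  have tight: "\<exists>I :: (nat, nat, nat) ebsp_instance.
      valid_instance I \<and> trips I \<noteq> {} \<and> one_bus_per_trip I \<and> N \<le> card (trips I) \<and>
      (\<exists>n m. is_min_courses (capped_linear 1) I n \<and> is_min_courses (capped_linear 2) I m \<and>
        n = card (trips I) * m)" for N
  proof (intro exI conjI)
    show "trips (relay_instance N) \<noteq> {}" "N \<le> card (trips (relay_instance N))"
      by (auto simp: relay_instance_def)
    show "card (trips (relay_instance N)) = card (trips (relay_instance N)) * 1"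
      by simp
  qed (rule valid_relay_instance one_bus_per_trip_relay_instance
      min_courses_relay_instance_slow min_courses_relay_instance_fast)+
  show "\<exists>\<zeta> \<zeta>'. charge_curve \<zeta> \<and> charge_curve \<zeta>' \<and>
            (\<forall>N. \<exists>I :: (nat, nat, nat) ebsp_instance.
               valid_instance I \<and> trips I \<noteq> {} \<and> one_bus_per_trip I \<and> N \<le> card (trips I) \<and>
               (\<exists>n m. is_min_courses \<zeta> I n \<and> is_min_courses \<zeta>' I m \<and> n = card (trips I) * m))"
    by (rule exI[of _ "capped_linear 1"], rule exI[of _ "capped_linear 2"])
      (intro conjI allI tight charge_curve_capped_linear; simp)
qed

end
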